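(* Let $(P,\cdot,[-,-],\varepsilon,\alpha,\beta)$ be a BiHom-Poisson color algebra and let $\theta:P\to P$ be an $\alpha^0$-averaging operator. Then the two new products $$x\ast y=\theta(x)\cdot\theta(y)\quad\text{and}\quad\{x,y\}=[\theta(x),\theta(y)],\qquad x,y\in P,$$ make $(P,\ast,\{-,-\},\varepsilon,\alpha,\beta)$ a BiHom-Poisson color algebra.
   Context: $\mathbb{K}$ is a field of characteristic different from 2 and $G$ is an abelian group (written additively). A skew-symmetric bicharacter on $G$ is a map $\varepsilon:G\times G\to\mathbb{K}^*$ with $\varepsilon(g,g')\varepsilon(g',g)=1$, $\varepsilon(g,g'+g'')=\varepsilon(g,g')\varepsilon(g,g'')$, $\varepsilon(g+g',g'')=\varepsilon(g,g'')\varepsilon(g',g'')$; $\varepsilon$ denotes such a bicharacter. For homogeneous $x,y$ of degrees $g,g'$ one writes $\varepsilon(x,y)=\varepsilon(g,g')$. A linear map is even if it preserves degrees; a bilinear map $\mu$ is even if $\mu(V_g,V_{g'})\subseteq V_{g+g'}$. A BiHom-Poisson color algebra $(P,\cdot,[-,-],\varepsilon,\alpha,\beta)$ is a $G$-graded $\mathbb{K}$-vector space $P$ with an even bilinear product $\cdot$, an even bilinear bracket $[-,-]$, and even linear maps $\alpha,\beta:P\to P$ such that $\alpha\beta=\beta\alpha$, $\alpha$ and $\beta$ are multiplicative for both the product and the bracket, and for all homogeneous $x,y,z$: - $\alpha(x)\cdot(y\cdot z)=(x\cdot y)\cdot\beta(z)$; - $[\beta(x),\alpha(y)]=-\varepsilon(x,y)[\beta(y),\alpha(x)]$;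 - $\oint_{x,y,z}\varepsilon(z,x)[\beta^2(x),[\beta(y),\alpha(z)]]=0$ (cyclic sum over $x,y,z$); - $[\alpha\beta(x),y\cdot z]=[\beta(x),y]\cdot\beta(z)+\varepsilon(x,y)\,\beta(y)\cdot[\alpha(x),z]$. An $(\alpha^k,\beta^l)$-averaging operator is an even linear map $\theta:P\to P$ with $\alpha\theta=\theta\alpha$, $\beta\theta=\theta\beta$, $\theta(\theta(x)\cdot\alpha^k\beta^l(y))=\theta(x)\cdot\theta(y)=\theta(\alpha^k\beta^l(x)\cdot\theta(y))$ and $\theta([\theta(x),\alpha^k\beta^l(y)])=[\theta(x),\theta(y)]=\theta([\alpha^k\beta^l(x),\theta(y)])$ for all homogeneous $x,y$. An $\alpha^0$-averaging operator is the case $k=l=0$ (so $\alpha^k\beta^l$ is replaced by the identity). *)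

theory Defs
  imports Complex_Main
begin

text \<open>
  The grading group is a type of class \<^class>\<open>ab_group_add\<close>, the base field a type of class
  \<^class>\<open>field\<close>, and vector spaces are given by \<^locale>\<open>vector_space\<close>; the hypothesis that the
  characteristic differs from 2 is not part of the definitions and is assumed separately.
\<close>

locale skew_bicharacter =
  fixes \<epsilon> :: "'g::ab_group_add \<Rightarrow> 'g \<Rightarrow> 'k::field"
  assumes nonzero: "\<epsilon> g h \<noteq> 0"
    and skew: "\<epsilon> g h * \<epsilon> h g = 1"
    and add_right: "\<epsilon> g (h + h') = \<epsilon> g h * \<epsilon> g h'"
    and add_left: "\<epsilon> (g + g') h = \<epsilon> g h * \<epsilon> g' h"

text \<open>
  The direct sum decomposition: each vector has exactly one family of homogeneous components
  of finite support summing to it.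
\<close>

locale graded_vector_space = vector_space scale
  for scale :: "'k::field \<Rightarrow> 'v::ab_group_add \<Rightarrow> 'v"  (infixr "*s" 75) +
  fixes V :: "'g::ab_group_add \<Rightarrow> 'v set"
  assumes homogeneous_subspace: "subspace (V g)"
    and direct_sum: "\<exists>!c. (\<forall>g. c g \<in> V g) \<and> finite {g. c g \<noteq> 0} \<and> v = (\<Sum>g | c g \<noteq> 0. c g)"
begin

definition even_linear :: "('v \<Rightarrow> 'v) \<Rightarrow> bool" where
  "even_linear f \<longleftrightarrow> Vector_Spaces.linear scale scale f \<and> (\<forall>g. \<forall>x\<in>V g. f x \<in> V g)"

definition even_bilinear :: "('v \<Rightarrow> 'v \<Rightarrow> 'v) \<Rightarrow> bool" where
  "even_bilinear m \<longleftrightarrow>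
     (\<forall>x. Vector_Spaces.linear scale scale (\<lambda>y. m x y)) \<and>
     (\<forall>y. Vector_Spaces.linear scale scale (\<lambda>x. m x y)) \<and>
     (\<forall>g h. \<forall>x\<in>V g. \<forall>y\<in>V h. m x y \<in> V (g + h))"

end

text \<open>
  Identities for homogeneous elements are quantified over the degrees as well, so that
  \<open>\<epsilon>(x, y)\<close> becomes \<open>\<epsilon> g h\<close> for \<open>x \<in> V g\<close>, \<open>y \<in> V h\<close>; this only matters for
  the zero vector, where all these identities are trivial.
\<close>

locale BiHom_Poisson_color_algebra =
  graded_vector_space scale V + skew_bicharacter \<epsilon>
  for scale :: "'k::field \<Rightarrow> 'v::ab_group_add \<Rightarrow> 'v"  (infixr "*s" 75)
    and V :: "'g::ab_group_add \<Rightarrow> 'v set"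
    and mult :: "'v \<Rightarrow> 'v \<Rightarrow> 'v"  (infixl "\<odot>" 70)
    and br :: "'v \<Rightarrow> 'v \<Rightarrow> 'v"
    and \<epsilon> :: "'g \<Rightarrow> 'g \<Rightarrow> 'k"
    and \<alpha> \<beta> :: "'v \<Rightarrow> 'v" +
  assumes mult_even: "even_bilinear (\<odot>)"
    and br_even: "even_bilinear br"
    and alpha_even: "even_linear \<alpha>"
    and beta_even: "even_linear \<beta>"
    and alpha_beta_commute: "\<alpha> (\<beta> x) = \<beta> (\<alpha> x)"
    and alpha_mult: "\<alpha> (x \<odot> y) = \<alpha> x \<odot> \<alpha> y"
    and beta_mult: "\<beta> (x \<odot> y) = \<beta> x \<odot> \<beta> y"
    and alpha_br: "\<alpha> (br x y) = br (\<alpha> x) (\<alpha> y)"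
    and beta_br: "\<beta> (br x y) = br (\<beta> x) (\<beta> y)"
    and BiHom_associative:
      "\<lbrakk>x \<in> V g; y \<in> V h; z \<in> V k\<rbrakk> \<Longrightarrow> \<alpha> x \<odot> (y \<odot> z) = (x \<odot> y) \<odot> \<beta> z"
    and BiHom_skew_symmetric:
      "\<lbrakk>x \<in> V g; y \<in> V h\<rbrakk> \<Longrightarrow> br (\<beta> x) (\<alpha> y) = - (\<epsilon> g h *s br (\<beta> y) (\<alpha> x))"
    and BiHom_Jacobi:
      "\<lbrakk>x \<in> V g; y \<in> V h; z \<in> V k\<rbrakk> \<Longrightarrow>
         \<epsilon> k g *s br (\<beta> (\<beta> x)) (br (\<beta> y) (\<alpha> z))
       + \<epsilon> g h *s br (\<beta> (\<beta> y)) (br (\<beta> z) (\<alpha> x))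
       + \<epsilon> h k *s br (\<beta> (\<beta> z)) (br (\<beta> x) (\<alpha> y)) = 0"
    and BiHom_Leibniz:
      "\<lbrakk>x \<in> V g; y \<in> V h; z \<in> V k\<rbrakk> \<Longrightarrow>
         br (\<alpha> (\<beta> x)) (y \<odot> z)
       = br (\<beta> x) y \<odot> \<beta> z + \<epsilon> g h *s (\<beta> y \<odot> br (\<alpha> x) z)"

locale averaging_operator =
  BiHom_Poisson_color_algebra scale V mult br \<epsilon> \<alpha> \<beta>
  for scale :: "'k::field \<Rightarrow> 'v::ab_group_add \<Rightarrow> 'v"  (infixr "*s" 75)
    and V :: "'g::ab_group_add \<Rightarrow> 'v set"
    and mult :: "'v \<Rightarrow> 'v \<Rightarrow> 'v"  (infixl "\<odot>" 70)
    and br :: "'v \<Rightarrow> 'v \<Rightarrow> 'v"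
    and \<epsilon> :: "'g \<Rightarrow> 'g \<Rightarrow> 'k"
    and \<alpha> \<beta> :: "'v \<Rightarrow> 'v" +
  fixes k l :: nat and \<theta> :: "'v \<Rightarrow> 'v"
  assumes theta_even: "even_linear \<theta>"
    and alpha_theta: "\<alpha> (\<theta> x) = \<theta> (\<alpha> x)"
    and beta_theta: "\<beta> (\<theta> x) = \<theta> (\<beta> x)"
    and theta_mult_left:
      "\<lbrakk>x \<in> V g; y \<in> V h\<rbrakk> \<Longrightarrow> \<theta> (\<theta> x \<odot> (\<alpha> ^^ k) ((\<beta> ^^ l) y)) = \<theta> x \<odot> \<theta> y"
    and theta_mult_right:
      "\<lbrakk>x \<in> V g; y \<in> V h\<rbrakk> \<Longrightarrow> \<theta> ((\<alpha> ^^ k) ((\<beta> ^^ l) x) \<odot> \<theta> y) = \<theta> x \<odot> \<theta> y"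
    and theta_br_left:
      "\<lbrakk>x \<in> V g; y \<in> V h\<rbrakk> \<Longrightarrow> \<theta> (br (\<theta> x) ((\<alpha> ^^ k) ((\<beta> ^^ l) y))) = br (\<theta> x) (\<theta> y)"
    and theta_br_right:
      "\<lbrakk>x \<in> V g; y \<in> V h\<rbrakk> \<Longrightarrow> \<theta> (br ((\<alpha> ^^ k) ((\<beta> ^^ l) x)) (\<theta> y)) = br (\<theta> x) (\<theta> y)"

abbreviation "alpha0_averaging_operator scale V mult br \<epsilon> \<alpha> \<beta> \<theta> \<equiv>
  averaging_operator scale V mult br \<epsilon> \<alpha> \<beta> 0 0 \<theta>"

end

theory Submission
  imports Defs
begin

text \<open>
  Every axiom of the new structure follows from the corresponding old one at \<open>\<theta> x\<close>, \<open>\<theta> y\<close>,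
  \<open>\<theta> z\<close>. The axioms with a single operation (multiplicativity, skew-symmetry) carry over
  because \<open>\<theta>\<close> is even and commutes with \<open>\<alpha>\<close> and \<open>\<beta>\<close>. In the axioms with two nested operations the inner
  operation is followed by an additional \<open>\<theta>\<close>, for instance
  \<open>\<alpha> x \<ast> (y \<ast> z) = \<theta> (\<alpha> x) \<cdot> \<theta> (\<theta> y \<cdot> \<theta> z)\<close>. For \<open>k = l = 0\<close> the averaging identities read
  \<open>\<theta> u \<cdot> \<theta> v = \<theta> (\<theta> u \<cdot> v) = \<theta> (u \<cdot> \<theta> v)\<close>, and likewise for the bracket, so this inner
  \<open>\<theta>\<close> can be pulled in front of the whole term:
  \<open>\<theta> (\<alpha> x) \<cdot> \<theta> (\<theta> y \<cdot> \<theta> z) = \<theta> (\<alpha> (\<theta> x) \<cdot> (\<theta> y \<cdot> \<theta> z))\<close>.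
  Hence both sides of associativity and of the Leibniz identity, and the left-hand side of the
  Jacobi identity, are \<open>\<theta>\<close> applied to the old expressions at \<open>\<theta> x\<close>, \<open>\<theta> y\<close>, \<open>\<theta> z\<close>, and
  linearity of \<open>\<theta>\<close> transfers the identities.
\<close>

lemma (in graded_vector_space) even_bilinear_precompose:
  assumes m: "even_bilinear m" and f: "even_linear f"
  shows "even_bilinear (\<lambda>x y. m (f x) (f y))"
proof -
  have lf: "Vector_Spaces.linear scale scale f"
    using f by (simp add: even_linear_def)
  have lin: "Vector_Spaces.linear scale scale (\<lambda>y. h (f y))"
    if "Vector_Spaces.linear scale scale h" for h
    using Vector_Spaces.linear_compose[OF lf that] by (simp add: o_def)
  show ?thesis
    using m f lin unfolding even_bilinear_def even_linear_def by blast
qed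

theorem theorem3p20:
  fixes scale :: "'k::field \<Rightarrow> 'v::ab_group_add \<Rightarrow> 'v"
    and V :: "'g::ab_group_add \<Rightarrow> 'v set"
    and mult br :: "'v \<Rightarrow> 'v \<Rightarrow> 'v"
    and \<epsilon> :: "'g \<Rightarrow> 'g \<Rightarrow> 'k"
    and \<alpha> \<beta> \<theta> :: "'v \<Rightarrow> 'v"
  assumes "CHAR('k) \<noteq> 2"
    and "BiHom_Poisson_color_algebra scale V mult br \<epsilon> \<alpha> \<beta>"
    and "alpha0_averaging_operator scale V mult br \<epsilon> \<alpha> \<beta> \<theta>"
  shows "BiHom_Poisson_color_algebra scale V
           (\<lambda>x y. mult (\<theta> x) (\<theta> y)) (\<lambda>x y. br (\<theta> x) (\<theta> y)) \<epsilon> \<alpha> \<beta>"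
proof -
  interpret averaging_operator scale V mult br \<epsilon> \<alpha> \<beta> 0 0 \<theta>
    by (rule assms(3))
  interpret \<theta>: Vector_Spaces.linear scale scale \<theta>
    using theta_even by (simp add: even_linear_def)
  note linear_simps = \<theta>.add \<theta>.scale \<theta>.zero
  have \<theta>_V: "\<theta> x \<in> V g" and \<alpha>_V: "\<alpha> x \<in> V g" and \<beta>_V: "\<beta> x \<in> V g" if "x \<in> V g" for x g
    using that theta_even alpha_even beta_even by (auto simp: even_linear_def)
  have mult_V: "mult x y \<in> V (g + h)" and br_V: "br x y \<in> V (g + h)"
    if "x \<in> V g" "y \<in> V h" for x y g h
    using that mult_even br_even by (auto simp: even_bilinear_def)
  note V_closed = \<theta>_V \<alpha>_V \<beta>_V mult_V br_V
  have pull_mult_left: "mult (\<theta> x) (\<theta> y) = \<theta> (mult (\<theta> x) y)"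
    and pull_mult_right: "mult (\<theta> x) (\<theta> y) = \<theta> (mult x (\<theta> y))"
    and pull_br_left: "br (\<theta> x) (\<theta> y) = \<theta> (br (\<theta> x) y)"
    if "x \<in> V g" "y \<in> V h" for x y g h
    using theta_mult_left[OF that] theta_mult_right[OF that] theta_br_left[OF that] by simp_all
  show ?thesis
  proof unfold_locales
    show "even_bilinear (\<lambda>x y. mult (\<theta> x) (\<theta> y))" "even_bilinear (\<lambda>x y. br (\<theta> x) (\<theta> y))"
      using even_bilinear_precompose mult_even br_even theta_even by blast+
  next
    show "mult (\<theta> (\<alpha> x)) (\<theta> (mult (\<theta> y) (\<theta> z))) = mult (\<theta> (mult (\<theta> x) (\<theta> y))) (\<theta> (\<beta> z))"
      if xyz: "x \<in> V g" "y \<in> V h" "z \<in> V k" for x y z g h k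
    proof -
      have "mult (\<theta> (\<alpha> x)) (\<theta> (mult (\<theta> y) (\<theta> z))) = \<theta> (mult (\<alpha> (\<theta> x)) (mult (\<theta> y) (\<theta> z)))"
        using pull_mult_left V_closed xyz by (metis alpha_theta)
      also have "\<dots> = \<theta> (mult (mult (\<theta> x) (\<theta> y)) (\<beta> (\<theta> z)))"
        using BiHom_associative \<theta>_V xyz by metis
      also have "\<dots> = mult (\<theta> (mult (\<theta> x) (\<theta> y))) (\<theta> (\<beta> z))"
        using pull_mult_right V_closed xyz by (metis beta_theta)
      finally show ?thesis .
    qed
  next
    show "br (\<theta> (\<beta> x)) (\<theta> (\<alpha> y)) = - scale (\<epsilon> g h) (br (\<theta> (\<beta> y)) (\<theta> (\<alpha> x)))"
      if "x \<in> V g" "y \<in> V h" for x y g h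
      using BiHom_skew_symmetric[OF \<theta>_V[OF that(1)] \<theta>_V[OF that(2)]]
      by (simp add: alpha_theta beta_theta)
  next
    have nested: "br (\<theta> (\<beta> (\<beta> x))) (\<theta> (br (\<theta> (\<beta> y)) (\<theta> (\<alpha> z))))
        = \<theta> (br (\<beta> (\<beta> (\<theta> x))) (br (\<beta> (\<theta> y)) (\<alpha> (\<theta> z))))"
      if "x \<in> V g" "y \<in> V h" "z \<in> V k" for x y z g h k
      using pull_br_left V_closed that by (metis alpha_theta beta_theta)
    show "scale (\<epsilon> k g) (br (\<theta> (\<beta> (\<beta> x))) (\<theta> (br (\<theta> (\<beta> y)) (\<theta> (\<alpha> z)))))
        + scale (\<epsilon> g h) (br (\<theta> (\<beta> (\<beta> y))) (\<theta> (br (\<theta> (\<beta> z)) (\<theta> (\<alpha> x)))))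
        + scale (\<epsilon> h k) (br (\<theta> (\<beta> (\<beta> z))) (\<theta> (br (\<theta> (\<beta> x)) (\<theta> (\<alpha> y))))) = 0"
      if xyz: "x \<in> V g" "y \<in> V h" "z \<in> V k" for x y z g h k
      using arg_cong[OF BiHom_Jacobi[OF \<theta>_V[OF xyz(1)] \<theta>_V[OF xyz(2)] \<theta>_V[OF xyz(3)]], of \<theta>]
      unfolding linear_simps nested[OF xyz] nested[OF xyz(2,3,1)] nested[OF xyz(3,1,2)] .
  next
    show "br (\<theta> (\<alpha> (\<beta> x))) (\<theta> (mult (\<theta> y) (\<theta> z)))
        = mult (\<theta> (br (\<theta> (\<beta> x)) (\<theta> y))) (\<theta> (\<beta> z))
        + scale (\<epsilon> g h) (mult (\<theta> (\<beta> y)) (\<theta> (br (\<theta> (\<alpha> x)) (\<theta> z))))"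
      if xyz: "x \<in> V g" "y \<in> V h" "z \<in> V k" for x y z g h k
    proof -
      have "br (\<theta> (\<alpha> (\<beta> x))) (\<theta> (mult (\<theta> y) (\<theta> z)))
          = \<theta> (br (\<alpha> (\<beta> (\<theta> x))) (mult (\<theta> y) (\<theta> z)))"
        using pull_br_left V_closed xyz by (metis alpha_theta beta_theta)
      also have "\<dots> = \<theta> (mult (br (\<beta> (\<theta> x)) (\<theta> y)) (\<beta> (\<theta> z)))
          + scale (\<epsilon> g h) (\<theta> (mult (\<beta> (\<theta> y)) (br (\<alpha> (\<theta> x)) (\<theta> z))))"
        unfolding BiHom_Leibniz[OF \<theta>_V[OF xyz(1)] \<theta>_V[OF xyz(2)] \<theta>_V[OF xyz(3)]] linear_simps ..
      also have "\<theta> (mult (br (\<beta> (\<theta> x)) (\<theta> y)) (\<beta> (\<theta> z)))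
          = mult (\<theta> (br (\<theta> (\<beta> x)) (\<theta> y))) (\<theta> (\<beta> z))"
        using pull_mult_right V_closed xyz by (metis beta_theta)
      also have "\<theta> (mult (\<beta> (\<theta> y)) (br (\<alpha> (\<theta> x)) (\<theta> z)))
          = mult (\<theta> (\<beta> y)) (\<theta> (br (\<theta> (\<alpha> x)) (\<theta> z)))"
        using pull_mult_left V_closed xyz by (metis alpha_theta beta_theta)
      finally show ?thesis .
    qed
  qed (simp_all add: alpha_even beta_even alpha_beta_commute alpha_theta beta_theta
      alpha_mult beta_mult alpha_br beta_br)
qed

end
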